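(* Let $C_{\operatorname{HL},b}$ and $\phi_{\operatorname{HL},b}$ be the sharp Tauberian constant and halo function of the uncentered Hardy–Littlewood maximal operator with respect to Euclidean balls in $\mathbb{R}^n$. Then $\phi_{\operatorname{HL},b}\in C^{1/(n+1)}([0,\infty))$, $C_{\operatorname{HL},b}\in C^{1/n}(0,1)$, and $\phi_{\operatorname{HL},b}\in C^{1/n}(1,\infty)$.
   Context: $M_{\operatorname{HL},b}f(x)=\sup_{x\in B}\frac1{|B|}\int_B|f|$, supremum over all Euclidean balls containing $x$. $C_{\operatorname{HL},b}(\alpha)=\sup_{E:\,0<|E|<\infty}\frac{1}{|E|}|\{x:M_{\operatorname{HL},b}\chi_E(x)>\alpha\}|$ for $\alpha\in(0,1)$; $\phi_{\operatorname{HL},b}(\alpha)=C_{\operatorname{HL},b}(1/\alpha)$ for $\alpha>1$ and $\phi_{\operatorname{HL},b}(\alpha)=\alpha$ for $\alpha\in[0,1]$. For an interval $I$, $f\in C^p(I)$ means: for every compact $K\subset I$ there is $C_K$ with $|f(x)-f(y)|\le C_K|x-y|^p$ for all $x,y\in K$. *)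

theory Defs
  imports "HOL-Analysis.Analysis"
begin

definition M_HL_b :: "('a::euclidean_space \<Rightarrow> real) \<Rightarrow> 'a \<Rightarrow> ennreal" where
  "M_HL_b f x = (SUP B \<in> {ball c r | c r. 0 < r \<and> x \<in> ball c r}.
       (\<integral>\<^sup>+ y\<in>B. ennreal \<bar>f y\<bar> \<partial>lebesgue) / emeasure lebesgue B)"

definition C_HL_b :: "'a::euclidean_space itself \<Rightarrow> real \<Rightarrow> real" where
  "C_HL_b _ \<alpha> = enn2real (SUP E \<in> {E :: 'a set. E \<in> sets lebesgue \<and>
        0 < emeasure lebesgue E \<and> emeasure lebesgue E < \<infinity>}.
     emeasure lebesgue {x. ennreal \<alpha> < M_HL_b (indicator E :: 'a \<Rightarrow> real) x}
       / emeasure lebesgue E)"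

definition phi_HL_b :: "'a::euclidean_space itself \<Rightarrow> real \<Rightarrow> real" where
  "phi_HL_b T \<alpha> = (if \<alpha> \<le> 1 then \<alpha> else C_HL_b T (1 / \<alpha>))"

definition holder_on :: "real \<Rightarrow> real set \<Rightarrow> (real \<Rightarrow> real) \<Rightarrow> bool" where
  "holder_on p I f \<longleftrightarrow> (\<forall>K. compact K \<and> K \<subseteq> I \<longrightarrow>
      (\<exists>C. \<forall>x\<in>K. \<forall>y\<in>K. \<bar>f x - f y\<bar> \<le> C * \<bar>x - y\<bar> powr p))"

end

(*
  Raising the density level from a to b costs little: adding to E a set that occupies the fraction
  theta = (b - a) / (1 - a) of the complement of E in every ball of a finite family turns balls of
  density a into balls of density b. With v = 1 / C this gives v b <= theta + (1 - theta) v a, that is,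
  (1 - v) / (1 - t) is nondecreasing in t. Hence C is locally Lipschitz on (0, 1), and the behaviour of
  phi at 1 only depends on the Solyanik estimate 1 - v t <= c (1 - t)^(1/(n+1)).

  For that estimate let W be a finite union of balls of density above 1 - d. Shrinking all the balls
  concentrically by the factor 1 - eta loses at most the fraction n eta of W. A point of the shrunken
  union outside E is the centre of a ball of radius eta r inside a ball of the family of radius r,
  so by Vitali's covering lemma these points have measure at most d (5 / eta)^n |W|.
  The choice eta = d^(1/(n+1)) balances both errors.
*)

theory Submission
  imports Defs
begin

section \<open>Ball geometry: Vitali covering and shrinking of unions\<close>

lemma measure_ball_scale:
  fixes c d :: "'a::euclidean_space"
  assumes "0 \<le> s" "0 \<le> r"
  shows "measure lebesgue (ball c (s * r)) = s ^ DIM('a) * measure lebesgue (ball d r)"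
  using assms by (simp add: content_ball power_mult_distrib mult.assoc mult.left_commute)

text \<open>Vitali's lemma selects disjoint balls whose fivefold enlargements still cover
  \<open>S\<close>, so the local inequalities add up: the left sides dominate \<open>S\<close>, the
  right sides measure disjoint pieces of \<open>E\<close>. Applied once with \<open>E\<close> the
  given set and once with \<open>E\<close> a union of balls.\<close>

lemma vitali_measure_bound:
  fixes S E :: "'a::euclidean_space set"
  assumes S: "S \<in> lmeasurable" and E: "E \<in> lmeasurable" and k: "0 \<le> k"
    and cov: "S \<subseteq> (\<Union>i\<in>K. ball (a i) (r i))"
    and r: "\<And>i. i \<in> K \<Longrightarrow> 0 < r i \<and> r i \<le> b"
    and loc: "\<And>i. i \<in> K \<Longrightarrow> measure lebesgue (S \<inter> ball (a i) (5 * r i))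
                 \<le> k * measure lebesgue (E \<inter> ball (a i) (r i))"
  shows "measure lebesgue S \<le> k * measure lebesgue E"
proof -
  obtain C where C: "countable C" "C \<subseteq> K"
    and dis: "pairwise (\<lambda>i j. disjnt (ball (a i) (r i)) (ball (a j) (r j))) C"
    and cov5: "S \<subseteq> (\<Union>i\<in>C. ball (a i) (5 * r i))"
    by (rule Vitali_covering_lemma_balls[OF cov r])
  \<comment> \<open>The selected family is only countable, so the bound is proved for its finite
    subfamilies and passed to the limit.\<close>
  have "measure lebesgue (\<Union>i\<in>C. S \<inter> ball (a i) (5 * r i)) \<le> k * measure lebesgue E"
  proof (rule measure_UN_bound[OF C(1)])
    show "S \<inter> ball (a i) (5 * r i) \<in> lmeasurable" for i
      using S by (intro fmeasurable_Int_fmeasurable) auto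
    fix I assume I: "I \<subseteq> C" "finite I"
    have m: "E \<inter> ball (a i) (r i) \<in> lmeasurable" for i
      using E by (intro fmeasurable_Int_fmeasurable) auto
    have "measure lebesgue (\<Union>i\<in>I. S \<inter> ball (a i) (5 * r i))
        \<le> (\<Sum>i\<in>I. measure lebesgue (S \<inter> ball (a i) (5 * r i)))"
      using I S by (intro measure_UNION_le) (auto simp: fmeasurableD)
    also have "\<dots> \<le> (\<Sum>i\<in>I. k * measure lebesgue (E \<inter> ball (a i) (r i)))"
      using I C(2) by (intro sum_mono loc) auto
    also have "\<dots> = k * measure lebesgue (\<Union>i\<in>I. E \<inter> ball (a i) (r i))"
      unfolding sum_distrib_left[symmetric]
    proof (subst measure_UNION'[OF I(2) m])
      show "pairwise (\<lambda>i j. disjnt (E \<inter> ball (a i) (r i)) (E \<inter> ball (a j) (r j))) I"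
        using pairwise_subset[OF dis I(1)] by (auto simp: pairwise_def disjnt_iff)
    qed simp
    also have "\<dots> \<le> k * measure lebesgue E"
      using E k m by (intro mult_left_mono measure_mono_fmeasurable fmeasurableD fmeasurable.finite_UN I) auto
    finally show "measure lebesgue (\<Union>i\<in>I. S \<inter> ball (a i) (5 * r i)) \<le> k * measure lebesgue E" .
  qed
  moreover have "(\<Union>i\<in>C. S \<inter> ball (a i) (5 * r i)) = S"
    using cov5 by blast
  ultimately show ?thesis by simp
qed

text \<open>Dissect the union into the power cells \<open>W i\<close>, on which the power
  \<open>|c i - x|\<^sup>2 - (r i)\<^sup>2\<close> is minimal at \<open>i\<close>, and shrink each cell towards its centre. The resulting
  map is strictly monotone, hence the shrunken cells stay disjoint.\<close>

lemma measure_Union_shrunk_balls: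
  fixes c :: "nat \<Rightarrow> 'a::euclidean_space"
  assumes I: "finite I" and r: "\<And>i. i \<in> I \<Longrightarrow> 0 < r i" and t: "0 < t" "t \<le> 1"
  shows "t ^ DIM('a) * measure lebesgue (\<Union>i\<in>I. ball (c i) (r i))
       \<le> measure lebesgue (\<Union>i\<in>I. ball (c i) (t * r i))"
proof -
  define p where "p i x = (dist (c i) x)\<^sup>2 - (r i)\<^sup>2" for i x
  \<comment> \<open>Ties between equal powers go to the smallest index, which makes the cells
    disjoint.\<close>
  define W where "W i = {x \<in> ball (c i) (r i). \<forall>j\<in>I. p i x \<le> p j x \<and> (j < i \<longrightarrow> p i x < p j x)}" for i
  define T where "T i x = t *\<^sub>R x + (1 - t) *\<^sub>R c i" for i x
  have W_borel: "W i \<in> sets borel" if "i \<in> I" for i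
  proof -
    have "W i = ball (c i) (r i) \<inter> (\<Inter>j\<in>I. {x. p i x \<le> p j x} \<inter> (if j < i then {x. p i x < p j x} else UNIV))"
      by (auto simp: W_def split: if_splits)
    moreover have "(\<Inter>j\<in>I. {x. p i x \<le> p j x} \<inter> (if j < i then {x. p i x < p j x} else UNIV)) \<in> sets borel"
      using I that unfolding p_def
      by (intro sets.finite_INT) (auto intro!: borel_closed borel_open closed_Collect_le open_Collect_less continuous_intros)
    ultimately show ?thesis by auto
  qed
  have W_meas: "W i \<in> lmeasurable" if "i \<in> I" for i
  proof (rule fmeasurableI2)
    show "W i \<subseteq> ball (c i) (r i)" by (auto simp: W_def)
    show "W i \<in> sets lebesgue" using W_borel[OF that] by auto
  qed auto
  have T_measure: "measure lebesgue (T i ` W i) = t ^ DIM('a) * measure lebesgue (W i)" for i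
    using t measure_lebesgue_affine[of t "(1 - t) *\<^sub>R c i" "W i"] by (simp add: T_def)
  have T_sub: "T i ` W i \<subseteq> ball (c i) (t * r i)" for i
  proof
    fix y assume "y \<in> T i ` W i"
    then obtain x where x: "x \<in> ball (c i) (r i)" "y = T i x" by (auto simp: W_def)
    have "c i - y = t *\<^sub>R (c i - x)" by (simp add: x T_def algebra_simps)
    then have "dist (c i) y = t * dist (c i) x" using t by (simp add: dist_norm)
    then show "y \<in> ball (c i) (t * r i)" using x t by simp
  qed
  have T_meas: "T i ` W i \<in> lmeasurable" if "i \<in> I" for i
  proof (rule fmeasurableI2[OF _ T_sub])
    \<comment> \<open>Measurability of the image is read off from the preimage under the inverse
      affine map.\<close>
    have "T i ` W i = (\<lambda>y. (1 / t) *\<^sub>R (y - (1 - t) *\<^sub>R c i)) -` W i"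
    proof (intro set_eqI iffI)
      fix y assume "y \<in> (\<lambda>y. (1 / t) *\<^sub>R (y - (1 - t) *\<^sub>R c i)) -` W i"
      then show "y \<in> T i ` W i"
        using t by (intro image_eqI[of _ _ "(1 / t) *\<^sub>R (y - (1 - t) *\<^sub>R c i)"]) (auto simp: T_def)
    qed (use t in \<open>auto simp: T_def\<close>)
    moreover have "(\<lambda>y. (1 / t) *\<^sub>R (y - (1 - t) *\<^sub>R c i)) -` W i \<in> sets borel"
      using W_borel[OF that]
      by (intro measurable_sets_borel borel_measurable_continuous_onI continuous_intros) auto
    ultimately show "T i ` W i \<in> sets lebesgue" by auto
  qed auto
  have cover: "(\<Union>i\<in>I. ball (c i) (r i)) \<subseteq> (\<Union>i\<in>I. W i)"
  proof
    fix x assume "x \<in> (\<Union>i\<in>I. ball (c i) (r i))"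
    then obtain j where j: "j \<in> I" "dist (c j) x < r j" by auto
    define A where "A = {i \<in> I. \<forall>k\<in>I. p i x \<le> p k x}"
    have "A \<noteq> {}"
    proof -
      have "Min ((\<lambda>i. p i x) ` I) \<in> (\<lambda>i. p i x) ` I" using I j by (intro Min_in) auto
      then obtain i where "i \<in> I" "p i x = Min ((\<lambda>i. p i x) ` I)" by auto
      then have "i \<in> A" using I by (auto simp: A_def)
      then show ?thesis by auto
    qed
    define i where "i = (LEAST i. i \<in> A)"
    have iA: "i \<in> A" unfolding i_def using \<open>A \<noteq> {}\<close> by (meson LeastI ex_in_conv)
    have least: "k \<notin> A" if "k < i" for k using that not_less_Least unfolding i_def by blast
    \<comment> \<open>A point lies in a ball exactly when its power is negative, so minimality at
      \<open>i\<close> puts \<open>x\<close> into ball \<open>i\<close>, although only ball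
      \<open>j\<close> was known to contain it.\<close>
    have "p i x \<le> p j x" using iA j by (simp add: A_def)
    also have "p j x < 0" using j by (simp add: p_def power_strict_mono)
    finally have "x \<in> ball (c i) (r i)"
      using iA r[of i] by (auto simp: p_def A_def intro: power_less_imp_less_base[of _ 2])
    moreover have "p i x \<le> p k x \<and> (k < i \<longrightarrow> p i x < p k x)" if "k \<in> I" for k
      using iA least[of k] that unfolding A_def by force
    ultimately show "x \<in> (\<Union>i\<in>I. W i)" using iA by (auto simp: W_def A_def)
  qed
  have disj: "disjnt (T i ` W i) (T j ` W j)" if ij: "i \<in> I" "j \<in> I" "i \<noteq> j" for i j
  proof (rule ccontr)
    assume "\<not> disjnt (T i ` W i) (T j ` W j)"
    then obtain x y where x: "x \<in> W i" and y: "y \<in> W j" and eq: "T i x = T j y"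
      by (auto simp: disjnt_iff)
    have "p i x \<le> p j x" "p j y \<le> p i y" using x y ij by (auto simp: W_def)
    \<comment> \<open>Adding the two minimality conditions cancels the radii; what remains is
      monotonicity of the assignment of centres to points.\<close>
    then have "(dist (c i) x)\<^sup>2 + (dist (c j) y)\<^sup>2 \<le> (dist (c j) x)\<^sup>2 + (dist (c i) y)\<^sup>2"
      by (simp add: p_def)
    then have mono: "0 \<le> (x - y) \<bullet> (c i - c j)"
      by (simp add: dist_norm power2_norm_eq_inner inner_diff inner_commute algebra_simps)
    \<comment> \<open>A positive multiple of \<open>|x - y|^2\<close> plus a nonnegative term
      vanishes, which forces \<open>x = y\<close>; this contradicts the tie-break.\<close>
    have "0 = (x - y) \<bullet> (T i x - T j y)" using eq by simp
    also have "\<dots> = t * ((x - y) \<bullet> (x - y)) + (1 - t) * ((x - y) \<bullet> (c i - c j))"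
      by (simp add: T_def inner_diff inner_add algebra_simps)
    finally have "t * ((x - y) \<bullet> (x - y)) \<le> 0" using mono t by (smt (verit) mult_nonneg_nonneg)
    then have "(x - y) \<bullet> (x - y) \<le> 0" using t by (simp add: mult_le_0_iff)
    then have "x - y = 0" using inner_gt_zero_iff[of "x - y"] by (metis not_le)
    then have "x = y" by simp
    then show False
      using x y ij by (cases "i < j") (force simp: W_def)+
  qed
  have "measure lebesgue (\<Union>i\<in>I. ball (c i) (r i)) \<le> measure lebesgue (\<Union>i\<in>I. W i)"
    using I W_meas cover by (intro measure_mono_fmeasurable fmeasurable.finite_UN fmeasurableD) auto
  also have "\<dots> \<le> (\<Sum>i\<in>I. measure lebesgue (W i))"
    using I W_meas by (intro measure_UNION_le fmeasurableD) auto
  finally have "t ^ DIM('a) * measure lebesgue (\<Union>i\<in>I. ball (c i) (r i))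
      \<le> t ^ DIM('a) * (\<Sum>i\<in>I. measure lebesgue (W i))"
    using t by (intro mult_left_mono) auto
  also have "\<dots> = measure lebesgue (\<Union>i\<in>I. T i ` W i)"
    using disj by (subst measure_UNION'[OF I T_meas]) (auto simp: T_measure sum_distrib_left pairwise_def)
  also have "\<dots> \<le> measure lebesgue (\<Union>i\<in>I. ball (c i) (t * r i))"
    using I T_meas by (intro measure_mono_fmeasurable UN_mono T_sub fmeasurable.finite_UN fmeasurableD) auto
  finally show ?thesis .
qed

section \<open>Subsets of prescribed proportion\<close>

text \<open>Cut \<open>A\<close> by balls about the origin. The measure cut out depends continuously
  on the radius and tends to that of \<open>A\<close>, so the intermediate value theorem reaches
  every proportion below 1.\<close>

lemma exists_subset_proportion:
  fixes A :: "'a::euclidean_space set"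
  assumes A: "A \<in> lmeasurable" and \<theta>: "0 \<le> \<theta>" "\<theta> < 1"
  shows "\<exists>G. G \<subseteq> A \<and> G \<in> lmeasurable \<and> measure lebesgue G = \<theta> * measure lebesgue A"
proof (cases "measure lebesgue A = 0")
  case True
  then show ?thesis by (intro exI[of _ "{}"]) auto
next
  case False
  define f where "f t = measure lebesgue (A \<inter> ball 0 t)" for t
  define h where "h t = measure lebesgue (ball (0::'a) t)" for t
  have m: "A \<inter> ball 0 t \<in> lmeasurable" for t
    using A by (intro fmeasurable_Int_fmeasurable) auto
  \<comment> \<open>Between two radii \<open>f\<close> grows at most as much as the ball volume
    \<open>h\<close>, whose continuity it inherits.\<close>
  have step: "f t - f s \<le> h t - h s \<and> f s \<le> f t" if "s \<le> t" for s t
  proof -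
    have sub: "ball (0::'a) s \<subseteq> ball 0 t" using that by auto
    have "f t - f s = measure lebesgue (A \<inter> ball 0 t - A \<inter> ball 0 s)"
      unfolding f_def using sub by (intro measurable_measure_Diff[symmetric] m fmeasurableD) auto
    moreover have "h t - h s = measure lebesgue (ball (0::'a) t - ball 0 s)"
      unfolding h_def using sub by (intro measurable_measure_Diff[symmetric]) auto
    moreover have "measure lebesgue (A \<inter> ball 0 t - A \<inter> ball 0 s) \<le> measure lebesgue (ball (0::'a) t - ball 0 s)"
      using m by (intro measure_mono_fmeasurable fmeasurable_Diff fmeasurableD) auto
    ultimately show ?thesis by (metis diff_ge_0_iff_ge measure_nonneg)
  qed
  have h_cont: "continuous_on {0..} h"
    by (rule continuous_on_eq[of _ "\<lambda>t. unit_ball_vol (real DIM('a)) * t ^ DIM('a)"])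
       (auto simp: h_def content_ball intro!: continuous_intros)
  have f_cont: "continuous_on {0..b} f" for b
  proof -
    have hc: "continuous_on {0..b} h" using h_cont by (rule continuous_on_subset) auto
    have "dist (f s) (f t) \<le> dist (h s) (h t)" for s t
      using step[of s t] step[of t s] by (cases "s \<le> t") (auto simp: dist_real_def)
    then show ?thesis using hc unfolding continuous_on_iff by (meson le_less_trans)
  qed
  have "(\<lambda>k. f (real k)) \<longlonglongrightarrow> measure lebesgue (\<Union>k. A \<inter> ball 0 (real k))"
    unfolding f_def
  proof (rule Lim_measure_incseq)
    show "range (\<lambda>k. A \<inter> ball 0 (real k)) \<subseteq> sets lebesgue" using m by auto
    show "incseq (\<lambda>k. A \<inter> ball 0 (real k))" by (auto simp: incseq_def)
    have "(\<Union>k. A \<inter> ball 0 (real k)) \<subseteq> A" by auto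
    then have "emeasure lebesgue (\<Union>k. A \<inter> ball 0 (real k)) \<le> emeasure lebesgue A"
      using A by (intro emeasure_mono) auto
    then show "emeasure lebesgue (\<Union>k. A \<inter> ball 0 (real k)) \<noteq> \<infinity>"
      using fmeasurableD2[OF A] by (auto simp: top_unique)
  qed
  also have "(\<Union>k. A \<inter> ball 0 (real k)) = A"
    using reals_Archimedean2 by auto
  finally have "eventually (\<lambda>k. \<theta> * measure lebesgue A < f (real k)) sequentially"
    by (rule order_tendstoD) (use \<theta> False in \<open>simp add: zero_less_measure_iff\<close>)
  then obtain k where k: "\<theta> * measure lebesgue A < f (real k)"
    by (meson eventually_sequentially order_refl)
  have "\<exists>t\<ge>0. t \<le> real k \<and> f t = \<theta> * measure lebesgue A"
    using \<theta> k f_cont by (intro IVT') (auto simp: f_def)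
  then obtain t where "f t = \<theta> * measure lebesgue A" by auto
  then show ?thesis using m by (intro exI[of _ "A \<inter> ball 0 t"]) (auto simp: f_def)
qed

text \<open>Inserting \<open>S\<close> splits \<open>A\<close> into its parts inside and outside
  \<open>S\<close>; the induction hypothesis applies to both parts, which is why \<open>A\<close>
  varies, and the two resulting sets are united. In effect each atom of the family is treated
  separately.\<close>

lemma exists_equidistributed_subset:
  fixes A :: "'a::euclidean_space set"
  assumes "finite \<F>" "\<F> \<subseteq> lmeasurable" "A \<in> lmeasurable" and \<theta>: "0 \<le> \<theta>" "\<theta> < 1"
  shows "\<exists>G. G \<subseteq> A \<and> G \<in> lmeasurable \<and> measure lebesgue G = \<theta> * measure lebesgue A
           \<and> (\<forall>B\<in>\<F>. measure lebesgue (G \<inter> B) = \<theta> * measure lebesgue (A \<inter> B))"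
  using assms(1-3)
proof (induction \<F> arbitrary: A rule: finite_induct)
  case empty
  then show ?case using exists_subset_proportion[OF _ \<theta>] by auto
next
  case (insert S \<F>)
  have S: "S \<in> lmeasurable" and F: "\<F> \<subseteq> lmeasurable" using insert.prems by auto
  have A1: "A \<inter> S \<in> lmeasurable" and A2: "A - S \<in> lmeasurable"
    using S insert.prems(2) by (auto intro: fmeasurable_Int_fmeasurable fmeasurable_Diff)
  obtain G1 where G1: "G1 \<subseteq> A \<inter> S" "G1 \<in> lmeasurable" "measure lebesgue G1 = \<theta> * measure lebesgue (A \<inter> S)"
    "\<And>B. B \<in> \<F> \<Longrightarrow> measure lebesgue (G1 \<inter> B) = \<theta> * measure lebesgue ((A \<inter> S) \<inter> B)"
    using insert.IH[OF F A1] by blast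
  obtain G2 where G2: "G2 \<subseteq> A - S" "G2 \<in> lmeasurable" "measure lebesgue G2 = \<theta> * measure lebesgue (A - S)"
    "\<And>B. B \<in> \<F> \<Longrightarrow> measure lebesgue (G2 \<inter> B) = \<theta> * measure lebesgue ((A - S) \<inter> B)"
    using insert.IH[OF F A2] by blast
  have add: "measure lebesgue (X \<union> Y) = measure lebesgue X + measure lebesgue Y"
    if "X \<in> lmeasurable" "Y \<in> lmeasurable" "X \<inter> Y = {}" for X Y :: "'a set"
    using that by (intro measure_Un2[THEN trans]) (auto simp: Diff_triv Int_commute)
  have mA: "measure lebesgue A = measure lebesgue (A \<inter> S) + measure lebesgue (A - S)"
  proof -
    have "(A \<inter> S) \<union> (A - S) = A" "(A \<inter> S) \<inter> (A - S) = {}" by auto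
    then show ?thesis using add[OF A1 A2] by simp
  qed
  have GU: "measure lebesgue (G1 \<union> G2) = \<theta> * measure lebesgue A"
    using add[OF G1(2) G2(2)] G1(1,3) G2(1,3) mA by (auto simp: algebra_simps)
  have "measure lebesgue ((G1 \<union> G2) \<inter> B) = \<theta> * measure lebesgue (A \<inter> B)" if B: "B \<in> insert S \<F>" for B
  proof (cases "B = S")
    case True
    have "(G1 \<union> G2) \<inter> S = G1" using G1(1) G2(1) by auto
    then show ?thesis using True G1(3) by simp
  next
    case False
    then have B: "B \<in> \<F>" using that by auto
    then have Bm: "B \<in> lmeasurable" using F by auto
    have i: "X \<inter> B \<in> lmeasurable" if "X \<in> lmeasurable" for X
      using that Bm by (auto intro: fmeasurable_Int_fmeasurable)
    have "measure lebesgue ((G1 \<inter> B) \<union> (G2 \<inter> B)) = measure lebesgue (G1 \<inter> B) + measure lebesgue (G2 \<inter> B)"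
      using G1 G2 by (intro add i) auto
    moreover have "measure lebesgue ((A \<inter> S \<inter> B) \<union> ((A - S) \<inter> B)) = measure lebesgue (A \<inter> S \<inter> B) + measure lebesgue ((A - S) \<inter> B)"
      using A1 A2 by (intro add i) auto
    moreover have "(G1 \<inter> B) \<union> (G2 \<inter> B) = (G1 \<union> G2) \<inter> B" "(A \<inter> S \<inter> B) \<union> ((A - S) \<inter> B) = A \<inter> B"
      by auto
    ultimately show ?thesis using G1(4)[OF B] G2(4)[OF B] by (simp add: algebra_simps)
  qed
  then show ?case using G1 G2 GU by (intro exI[of _ "G1 \<union> G2"]) auto
qed

section \<open>Reduction to finite families of balls\<close>

definition dense_balls :: "real \<Rightarrow> 'a::euclidean_space set \<Rightarrow> 'a set set" where
  "dense_balls \<alpha> E = {ball c r | c r. 0 < r \<and>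
     \<alpha> * measure lebesgue (ball c r) < measure lebesgue (E \<inter> ball c r)}"

text \<open>Only finite families occur, so all measures are finite reals. For \<alpha> \<ge> 0, once
  some bound is known, \<open>C_HL_b\<close> is the least one, by \<open>C_HL_b_le\<close> and
  \<open>tauberian_bound_C_HL_b\<close>.\<close>

definition tauberian_bound :: "'a::euclidean_space itself \<Rightarrow> real \<Rightarrow> real \<Rightarrow> bool" where
  "tauberian_bound _ \<alpha> k \<longleftrightarrow> 0 \<le> k \<and> (\<forall>(E::'a set) \<F>.
     E \<in> lmeasurable \<and> finite \<F> \<and> \<F> \<subseteq> dense_balls \<alpha> E \<longrightarrow>
       measure lebesgue (\<Union>\<F>) \<le> k * measure lebesgue E)"

lemma M_HL_b_indicator:
  fixes E :: "'a::euclidean_space set"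
  assumes E: "E \<in> sets lebesgue"
  shows "M_HL_b (indicator E) x = (SUP B \<in> {ball c r | c r. 0 < r \<and> x \<in> ball c r}.
           ennreal (measure lebesgue (E \<inter> B) / measure lebesgue B))"
  unfolding M_HL_b_def
proof (rule SUP_cong[OF refl])
  fix B assume "B \<in> {ball c r | c r. 0 < r \<and> x \<in> ball c r}"
  then obtain c r where B: "B = ball c r" "0 < r" by auto
  have Bm: "B \<in> lmeasurable" using B by simp
  have EB: "E \<inter> B \<in> lmeasurable"
    using E Bm by (metis Int_commute fmeasurable_Int_fmeasurable)
  have "(\<integral>\<^sup>+ y\<in>B. ennreal \<bar>indicator E y :: real\<bar> \<partial>lebesgue) = (\<integral>\<^sup>+ y. indicator (E \<inter> B) y \<partial>lebesgue)"
    by (intro nn_integral_cong) (auto simp: indicator_def)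
  also have "\<dots> = ennreal (measure lebesgue (E \<inter> B))"
    using EB by (simp add: emeasure_eq_measure2)
  finally show "(\<integral>\<^sup>+ y\<in>B. ennreal \<bar>indicator E y :: real\<bar> \<partial>lebesgue) / emeasure lebesgue B
      = ennreal (measure lebesgue (E \<inter> B) / measure lebesgue B)"
    using Bm B by (simp add: emeasure_eq_measure2 divide_ennreal)
qed

lemma halo_eq_Union_dense_balls:
  fixes E :: "'a::euclidean_space set"
  assumes E: "E \<in> sets lebesgue" and \<alpha>: "0 \<le> \<alpha>"
  shows "{x. ennreal \<alpha> < M_HL_b (indicator E) x} = \<Union>(dense_balls \<alpha> E)"
proof -
  have "ennreal \<alpha> < ennreal (measure lebesgue (E \<inter> ball c r) / measure lebesgue (ball c r))
      \<longleftrightarrow> \<alpha> * measure lebesgue (ball c r) < measure lebesgue (E \<inter> ball c r)" if "0 < r" for c :: 'a and r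
    using that \<alpha> by (simp add: ennreal_less_iff pos_less_divide_eq)
  then show ?thesis
    unfolding M_HL_b_indicator[OF E] less_SUP_iff dense_balls_def by blast
qed

lemma open_dense_balls: "B \<in> dense_balls \<alpha> E \<Longrightarrow> open B"
  by (auto simp: dense_balls_def)

lemma lmeasurable_dense_balls: "B \<in> dense_balls \<alpha> E \<Longrightarrow> B \<in> lmeasurable"
  by (auto simp: dense_balls_def)

lemma lmeasurable_Union_dense_balls:
  assumes "finite \<F>" "\<F> \<subseteq> dense_balls \<alpha> E"
  shows "\<Union>\<F> \<in> lmeasurable"
  using assms lmeasurable_dense_balls by (intro fmeasurable.finite_Union) auto

text \<open>Lindelof's theorem reduces the union of all dense balls to a countable one, and a bound
  uniform over finite subfamilies passes to countable unions.\<close>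

lemma emeasure_halo_le:
  fixes E :: "'a::euclidean_space set"
  assumes k: "tauberian_bound TYPE('a) \<alpha> k" and E: "E \<in> lmeasurable"
  shows "emeasure lebesgue (\<Union>(dense_balls \<alpha> E)) \<le> ennreal (k * measure lebesgue E)"
proof -
  obtain \<D> where D: "\<D> \<subseteq> dense_balls \<alpha> E" "countable \<D>" "\<Union>\<D> = \<Union>(dense_balls \<alpha> E)"
    using Lindelof[of "dense_balls \<alpha> E"] open_dense_balls by metis
  have m: "B \<in> lmeasurable" if "B \<in> \<D>" for B
    using D(1) that lmeasurable_dense_balls by blast
  have b: "measure lebesgue (\<Union>\<F>) \<le> k * measure lebesgue E" if "\<F> \<subseteq> \<D>" "finite \<F>" for \<F>
    using k E that D(1) unfolding tauberian_bound_def by blast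
  have "\<Union>\<D> \<in> lmeasurable" by (rule fmeasurable_Union_bound[OF D(2) m b])
  then have "emeasure lebesgue (\<Union>\<D>) = ennreal (measure lebesgue (\<Union>\<D>))"
    by (rule emeasure_eq_measure2)
  also have "\<dots> \<le> ennreal (k * measure lebesgue E)"
    by (intro ennreal_leI measure_Union_bound[OF D(2) m b])
  finally show ?thesis by (simp add: D)
qed

text \<open>Stated before \<open>enn2real\<close> is applied, so that it bounds
  \<open>C_HL_b\<close> and also shows that the supremum is finite.\<close>

lemma C_HL_b_SUP_le:
  assumes k: "tauberian_bound TYPE('a::euclidean_space) \<alpha> k" and \<alpha>: "0 \<le> \<alpha>"
  shows "(SUP E \<in> {E :: 'a set. E \<in> sets lebesgue \<and>
        0 < emeasure lebesgue E \<and> emeasure lebesgue E < \<infinity>}.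
     emeasure lebesgue {x. ennreal \<alpha> < M_HL_b (indicator E :: 'a \<Rightarrow> real) x}
       / emeasure lebesgue E) \<le> ennreal k"
proof (rule SUP_least, clarify)
  fix E :: "'a set"
  assume E: "E \<in> sets lebesgue" "0 < emeasure lebesgue E" "emeasure lebesgue E < \<infinity>"
  then have Em: "E \<in> lmeasurable" by (auto intro: fmeasurableI)
  have pos: "0 < measure lebesgue E" using E Em by (simp add: emeasure_eq_measure2)
  have k0: "0 \<le> k" using k by (simp add: tauberian_bound_def)
  have "emeasure lebesgue (\<Union>(dense_balls \<alpha> E)) / emeasure lebesgue E
      \<le> ennreal (k * measure lebesgue E) / ennreal (measure lebesgue E)"
    unfolding emeasure_eq_measure2[OF Em] by (rule divide_right_mono_ennreal[OF emeasure_halo_le[OF k Em]])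
  also have "\<dots> = ennreal k" using pos k0 by (simp add: divide_ennreal)
  finally show "emeasure lebesgue {x. ennreal \<alpha> < M_HL_b (indicator E :: 'a \<Rightarrow> real) x}
       / emeasure lebesgue E \<le> ennreal k"
    by (simp add: halo_eq_Union_dense_balls[OF E(1) \<alpha>])
qed

lemma C_HL_b_le:
  assumes k: "tauberian_bound TYPE('a::euclidean_space) \<alpha> k" and \<alpha>: "0 \<le> \<alpha>"
  shows "C_HL_b TYPE('a) \<alpha> \<le> k"
  using C_HL_b_SUP_le[OF assms] k unfolding C_HL_b_def
  by (intro enn2real_leI) (auto simp: tauberian_bound_def)

text \<open>A finite bound has to be known first: otherwise the supremum could be infinite, and
  \<^const>\<open>enn2real\<close> would send it to \<open>0\<close>.\<close>

lemma tauberian_bound_C_HL_b: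
  assumes k: "tauberian_bound TYPE('a::euclidean_space) \<alpha> k" and \<alpha>: "0 \<le> \<alpha>"
  shows "tauberian_bound TYPE('a) \<alpha> (C_HL_b TYPE('a) \<alpha>)"
  unfolding tauberian_bound_def
proof (intro conjI allI impI; (elim conjE)?)
  show "0 \<le> C_HL_b TYPE('a) \<alpha>" by (simp add: C_HL_b_def)
  fix E :: "'a set" and \<F>
  assume E: "E \<in> lmeasurable" and F: "finite \<F>" "\<F> \<subseteq> dense_balls \<alpha> E"
  define S where "S = (SUP E \<in> {E :: 'a set. E \<in> sets lebesgue \<and>
        0 < emeasure lebesgue E \<and> emeasure lebesgue E < \<infinity>}.
     emeasure lebesgue {x. ennreal \<alpha> < M_HL_b (indicator E :: 'a \<Rightarrow> real) x}
       / emeasure lebesgue E)"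
  have "S \<le> ennreal k" unfolding S_def by (rule C_HL_b_SUP_le[OF k \<alpha>])
  then have S: "S = ennreal (C_HL_b TYPE('a) \<alpha>)"
    unfolding C_HL_b_def S_def[symmetric] by (metis ennreal_enn2real ennreal_less_top le_less_trans)
  show "measure lebesgue (\<Union>\<F>) \<le> C_HL_b TYPE('a) \<alpha> * measure lebesgue E"
  proof (cases "measure lebesgue E = 0")
    case True
    \<comment> \<open>Null sets do not enter the supremum; the a priori bound \<open>k\<close>
      settles them.\<close>
    have "measure lebesgue (\<Union>\<F>) \<le> k * measure lebesgue E"
      using k E F unfolding tauberian_bound_def by blast
    then show ?thesis using True by simp
  next
    case False
    then have pos: "0 < measure lebesgue E" by (simp add: zero_less_measure_iff)
    have "emeasure lebesgue {x. ennreal \<alpha> < M_HL_b (indicator E :: 'a \<Rightarrow> real) x} / emeasure lebesgue E \<le> S"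
      unfolding S_def using E pos by (intro SUP_upper) (auto simp: emeasure_eq_measure2)
    then have le: "emeasure lebesgue (\<Union>(dense_balls \<alpha> E)) / ennreal (measure lebesgue E) \<le> S"
      using E \<alpha> by (simp add: halo_eq_Union_dense_balls fmeasurableD emeasure_eq_measure2)
    have "ennreal (measure lebesgue (\<Union>\<F>) / measure lebesgue E)
        = emeasure lebesgue (\<Union>\<F>) / ennreal (measure lebesgue E)"
      using lmeasurable_Union_dense_balls[OF F] pos by (simp add: emeasure_eq_measure2 divide_ennreal)
    also have "\<dots> \<le> emeasure lebesgue (\<Union>(dense_balls \<alpha> E)) / ennreal (measure lebesgue E)"
    proof (intro divide_right_mono_ennreal emeasure_mono)
      have "open (\<Union>(dense_balls \<alpha> E))" by (intro open_Union ballI open_dense_balls)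
      then show "\<Union>(dense_balls \<alpha> E) \<in> sets lebesgue" by auto
      show "\<Union>\<F> \<subseteq> \<Union>(dense_balls \<alpha> E)" by (rule Union_mono[OF F(2)])
    qed
    also note le
    finally have "measure lebesgue (\<Union>\<F>) / measure lebesgue E \<le> C_HL_b TYPE('a) \<alpha>"
      unfolding S by (subst (asm) ennreal_le_iff) (simp_all add: C_HL_b_def)
    then show ?thesis using pos by (simp add: pos_divide_le_eq)
  qed
qed

section \<open>A priori bounds for the Tauberian constant\<close>

text \<open>Vitali's lemma applies because a ball of density above \<alpha> has measure below
  \<open>1 / \<alpha>\<close> times that of its part in \<open>E\<close>. The purpose is finiteness
  of the supremum that defines \<open>C_HL_b\<close>.\<close>

lemma tauberian_bound_weak_type:
  assumes \<alpha>: "0 < \<alpha>"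
  shows "tauberian_bound TYPE('a::euclidean_space) \<alpha> (5 ^ DIM('a) / \<alpha>)"
  unfolding tauberian_bound_def
proof (intro conjI allI impI; (elim conjE)?)
  show "0 \<le> 5 ^ DIM('a) / \<alpha>" using \<alpha> by simp
  fix E :: "'a set" and \<F>
  assume E: "E \<in> lmeasurable" and F: "finite \<F>" "\<F> \<subseteq> dense_balls \<alpha> E"
  obtain c r where cr: "B = ball (c B) (r B)" "0 < r B"
      "\<alpha> * measure lebesgue B < measure lebesgue (E \<inter> B)" if "B \<in> \<F>" for B
    using F(2) unfolding dense_balls_def subset_iff mem_Collect_eq by metis
  show "measure lebesgue (\<Union>\<F>) \<le> 5 ^ DIM('a) / \<alpha> * measure lebesgue E"
  proof (rule vitali_measure_bound[where K = \<F> and a = c and r = r and b = "Max (r ` \<F>)"])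
    show "\<Union>\<F> \<in> lmeasurable" by (rule lmeasurable_Union_dense_balls[OF F])
    show "\<Union>\<F> \<subseteq> (\<Union>B\<in>\<F>. ball (c B) (r B))" using cr(1) by blast
    show "0 < r B \<and> r B \<le> Max (r ` \<F>)" if "B \<in> \<F>" for B using that cr(2) F(1) by auto
    show "measure lebesgue (\<Union>\<F> \<inter> ball (c B) (5 * r B))
        \<le> 5 ^ DIM('a) / \<alpha> * measure lebesgue (E \<inter> ball (c B) (r B))" if B: "B \<in> \<F>" for B
    proof -
      have "measure lebesgue (\<Union>\<F> \<inter> ball (c B) (5 * r B)) \<le> measure lebesgue (ball (c B) (5 * r B))"
        using lmeasurable_Union_dense_balls[OF F] by (intro measure_mono_fmeasurable) (auto simp: fmeasurableD)
      also have "\<dots> = 5 ^ DIM('a) * measure lebesgue B"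
        using cr(2)[OF B] measure_ball_scale[of 5 "r B" "c B" "c B"] cr(1)[OF B] by simp
      also have "\<dots> \<le> 5 ^ DIM('a) * (measure lebesgue (E \<inter> B) / \<alpha>)"
        using cr(3)[OF B] \<alpha> by (intro mult_left_mono) (auto simp: field_simps)
      finally show ?thesis using cr(1)[OF B] by simp
    qed
  qed (use E \<alpha> in auto)
qed

text \<open>Tested on the unit ball, which has density 1 in itself.\<close>

lemma C_HL_b_ge_1:
  assumes \<alpha>: "0 < \<alpha>" "\<alpha> < 1"
  shows "1 \<le> C_HL_b TYPE('a::euclidean_space) \<alpha>"
proof -
  let ?B = "ball (0::'a) 1"
  have "tauberian_bound TYPE('a) \<alpha> (C_HL_b TYPE('a) \<alpha>)"
    using tauberian_bound_C_HL_b[OF tauberian_bound_weak_type] \<alpha> by simp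
  moreover have "{?B} \<subseteq> dense_balls \<alpha> ?B"
    using \<alpha> by (auto simp: dense_balls_def intro!: exI[of _ "0::'a"] exI[of _ "1::real"])
  ultimately have "measure lebesgue (\<Union>{?B}) \<le> C_HL_b TYPE('a) \<alpha> * measure lebesgue ?B"
    unfolding tauberian_bound_def by (metis finite.emptyI finite.insertI lmeasurable_ball)
  then show ?thesis by simp
qed

lemma C_HL_b_antimono:
  assumes "0 < \<alpha>" "\<alpha> \<le> \<beta>"
  shows "C_HL_b TYPE('a::euclidean_space) \<beta> \<le> C_HL_b TYPE('a) \<alpha>"
proof (rule C_HL_b_le)
  have "tauberian_bound TYPE('a) \<alpha> (C_HL_b TYPE('a) \<alpha>)"
    using tauberian_bound_C_HL_b[OF tauberian_bound_weak_type] assms by simp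
  moreover have "dense_balls \<beta> E \<subseteq> dense_balls \<alpha> E" for E :: "'a set"
  proof -
    have "\<alpha> * measure lebesgue B \<le> \<beta> * measure lebesgue B" for B :: "'a set"
      using assms by (intro mult_right_mono) auto
    then show ?thesis unfolding dense_balls_def by (blast intro: le_less_trans)
  qed
  ultimately show "tauberian_bound TYPE('a) \<beta> (C_HL_b TYPE('a) \<alpha>)"
    unfolding tauberian_bound_def by (meson subset_trans)
qed (use assms in auto)

section \<open>The deficit \<open>1 - 1 / C\<close>: Solyanik estimate and monotonicity\<close>

text \<open>Numbering the balls provides the linear order on indices that the tie-break in
  \<open>measure_Union_shrunk_balls\<close> uses.\<close>

lemma dense_balls_indexed:
  assumes F: "finite \<F>" "\<F> \<subseteq> dense_balls \<alpha> E"
  obtains I :: "nat set" and c r where "finite I" "\<Union>\<F> = (\<Union>i\<in>I. ball (c i) (r i))"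
    "\<forall>i\<in>I. 0 < r i \<and> \<alpha> * measure lebesgue (ball (c i) (r i)) < measure lebesgue (E \<inter> ball (c i) (r i))"
proof -
  have "\<forall>B\<in>\<F>. \<exists>c r. B = ball c r \<and> 0 < r \<and> \<alpha> * measure lebesgue (ball c r) < measure lebesgue (E \<inter> ball c r)"
    using F(2) by (force simp: dense_balls_def)
  then obtain c r where cr: "\<forall>B\<in>\<F>. B = ball (c B) (r B) \<and> 0 < r B \<and>
      \<alpha> * measure lebesgue (ball (c B) (r B)) < measure lebesgue (E \<inter> ball (c B) (r B))"
    by metis
  obtain h where h: "\<F> = h ` {0..<card \<F>}"
    using ex_bij_betw_nat_finite[OF F(1)] by (metis bij_betw_imp_surj_on)
  have hF: "h i \<in> \<F>" if "i \<in> {0..<card \<F>}" for i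
    using h that by blast
  have "\<Union>(h ` {0..<card \<F>}) = (\<Union>i\<in>{0..<card \<F>}. ball (c (h i)) (r (h i)))"
    using cr hF by (intro SUP_cong) auto
  then have "\<Union>\<F> = (\<Union>i\<in>{0..<card \<F>}. ball (c (h i)) (r (h i)))"
    using h by metis
  moreover have "\<forall>i\<in>{0..<card \<F>}. 0 < r (h i) \<and>
      \<alpha> * measure lebesgue (ball (c (h i)) (r (h i))) < measure lebesgue (E \<inter> ball (c (h i)) (r (h i)))"
    using cr hF by blast
  ultimately show ?thesis
    by (intro that[of "{0..<card \<F>}" "\<lambda>i. c (h i)" "\<lambda>i. r (h i)"]) auto
qed

text \<open>The union is covered by \<open>E\<close>, the shell \<open>\<Union>\<F> - D\<close> lost
  by shrinking, and the part \<open>A\<close> of the shrunken union outside \<open>E\<close>. The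
  two summands of the factor pay for the shell and for \<open>A\<close>.\<close>

lemma dense_balls_union_bound:
  fixes E :: "'a::euclidean_space set"
  assumes E: "E \<in> lmeasurable" and F: "finite \<F>" "\<F> \<subseteq> dense_balls \<alpha> E"
    and \<alpha>: "\<alpha> \<le> 1" and \<eta>: "0 < \<eta>" "\<eta> < 1"
  shows "measure lebesgue (\<Union>\<F>) \<le> measure lebesgue E
     + (real DIM('a) * \<eta> + (1 - \<alpha>) * (5 / \<eta>) ^ DIM('a)) * measure lebesgue (\<Union>\<F>)"
proof -
  obtain I :: "nat set" and c r where I: "finite I" and W: "\<Union>\<F> = (\<Union>i\<in>I. ball (c i) (r i))"
    and rd: "\<forall>i\<in>I. 0 < r i \<and> \<alpha> * measure lebesgue (ball (c i) (r i)) < measure lebesgue (E \<inter> ball (c i) (r i))"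
    by (rule dense_balls_indexed[OF F])
  have r: "0 < r i" if "i \<in> I" for i using rd that by blast
  have dense: "\<alpha> * measure lebesgue (ball (c i) (r i)) < measure lebesgue (E \<inter> ball (c i) (r i))"
    if "i \<in> I" for i using rd that by blast
  define D where "D = (\<Union>i\<in>I. ball (c i) ((1 - \<eta>) * r i))"
  define A where "A = D - E"
  have Wm: "\<Union>\<F> \<in> lmeasurable" by (rule lmeasurable_Union_dense_balls[OF F])
  have Dm: "D \<in> lmeasurable" unfolding D_def using I by (intro fmeasurable.finite_UN) auto
  have Am: "A \<in> lmeasurable" unfolding A_def using Dm E by (intro fmeasurable_Diff fmeasurableD)
  have DW: "D \<subseteq> \<Union>\<F>"
    unfolding D_def W
  proof (intro UN_mono order_refl subset_ball)
    fix i assume "i \<in> I"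
    then show "(1 - \<eta>) * r i \<le> r i" using r[of i] \<eta> by (simp add: mult_le_cancel_right1)
  qed
  \<comment> \<open>Bernoulli's inequality linearizes the volume factor of the shrinking.\<close>
  have "1 - real DIM('a) * \<eta> \<le> (1 - \<eta>) ^ DIM('a)"
    using Bernoulli_inequality[of "- \<eta>" "DIM('a)"] \<eta> by simp
  then have "(1 - real DIM('a) * \<eta>) * measure lebesgue (\<Union>\<F>) \<le> (1 - \<eta>) ^ DIM('a) * measure lebesgue (\<Union>\<F>)"
    by (intro mult_right_mono) auto
  also have "\<dots> \<le> measure lebesgue D"
    unfolding D_def W using \<eta> by (intro measure_Union_shrunk_balls I r) auto
  finally have shell: "measure lebesgue (\<Union>\<F> - D) \<le> real DIM('a) * \<eta> * measure lebesgue (\<Union>\<F>)"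
    using Wm Dm DW by (subst measurable_measure_Diff) (auto simp: algebra_simps fmeasurableD)
  have deep: "measure lebesgue A \<le> (1 - \<alpha>) * (5 / \<eta>) ^ DIM('a) * measure lebesgue (\<Union>\<F>)"
  proof -
    have "\<forall>x\<in>A. \<exists>i\<in>I. x \<in> ball (c i) ((1 - \<eta>) * r i)" by (auto simp: A_def D_def)
    then obtain g where g: "\<And>x. x \<in> A \<Longrightarrow> g x \<in> I \<and> x \<in> ball (c (g x)) ((1 - \<eta>) * r (g x))"
      by metis
    \<comment> \<open>The fivefold enlargement in Vitali's lemma then has radius \<eta> times that
      of the chosen ball, and since \<open>x\<close> lies in the shrunken ball it stays inside the
      original one.\<close>
    let ?\<rho> = "\<lambda>x. \<eta> / 5 * r (g x)"
    show ?thesis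
    proof (rule vitali_measure_bound[where K = A and a = "\<lambda>x. x" and r = ?\<rho> and b = "Max (r ` I)"])
      show "0 \<le> (1 - \<alpha>) * (5 / \<eta>) ^ DIM('a)" using \<alpha> \<eta> by simp
      show pos: "0 < ?\<rho> x \<and> ?\<rho> x \<le> Max (r ` I)" if "x \<in> A" for x
      proof -
        have rg: "0 < r (g x)" and rM: "r (g x) \<le> Max (r ` I)" using g[OF that] r I by auto
        have "?\<rho> x \<le> 1 * r (g x)" using rg \<eta> by (intro mult_right_mono) auto
        then have "?\<rho> x \<le> Max (r ` I)" using rM by linarith
        then show ?thesis using rg \<eta> by simp
      qed
      show "A \<subseteq> (\<Union>x\<in>A. ball x (?\<rho> x))" using pos by fastforce
      show "measure lebesgue (A \<inter> ball x (5 * ?\<rho> x))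
          \<le> (1 - \<alpha>) * (5 / \<eta>) ^ DIM('a) * measure lebesgue (\<Union>\<F> \<inter> ball x (?\<rho> x))" if x: "x \<in> A" for x
      proof -
        let ?B = "ball (c (g x)) (r (g x))"
        have rg: "0 < r (g x)" using g[OF x] r by auto
        have big: "ball x (5 * ?\<rho> x) \<subseteq> ?B"
        proof
          fix y assume "y \<in> ball x (5 * ?\<rho> x)"
          then have "dist x y < \<eta> * r (g x)" by simp
          moreover have "dist (c (g x)) x < (1 - \<eta>) * r (g x)" using g[OF x] by simp
          ultimately have "dist (c (g x)) y < (1 - \<eta>) * r (g x) + \<eta> * r (g x)"
            using dist_triangle[of "c (g x)" y x] by linarith
          then show "y \<in> ?B" by (simp add: algebra_simps)
        qed
        have "ball x (?\<rho> x) \<subseteq> ball x (5 * ?\<rho> x)" using pos[OF x] by (intro subset_ball) auto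
        also note big
        also have "?B \<subseteq> \<Union>\<F>" using g[OF x] W by auto
        \<comment> \<open>The small ball lies inside the union, so the right side of the local
          inequality contains its full measure.\<close>
        finally have small: "\<Union>\<F> \<inter> ball x (?\<rho> x) = ball x (?\<rho> x)" by blast
        have Bm: "?B \<in> lmeasurable" and EB: "E \<inter> ?B \<in> lmeasurable"
          using E by (auto intro: fmeasurable_Int_fmeasurable)
        have "measure lebesgue (A \<inter> ball x (5 * ?\<rho> x)) \<le> measure lebesgue (?B - E \<inter> ?B)"
        proof (rule measure_mono_fmeasurable)
          show "A \<inter> ball x (5 * ?\<rho> x) \<subseteq> ?B - E \<inter> ?B" using big by (auto simp: A_def)
          show "A \<inter> ball x (5 * ?\<rho> x) \<in> sets lebesgue" using Am by (auto simp: fmeasurableD)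
          show "?B - E \<inter> ?B \<in> lmeasurable" using Bm EB by (intro fmeasurable_Diff fmeasurableD)
        qed
        also have "\<dots> = measure lebesgue ?B - measure lebesgue (E \<inter> ?B)"
          using Bm EB by (intro measurable_measure_Diff) (auto simp: fmeasurableD)
        also have "\<dots> \<le> (1 - \<alpha>) * measure lebesgue ?B"
          using dense[of "g x"] g[OF x] by (simp add: algebra_simps)
        \<comment> \<open>The inserted factor \<open>(\<eta> / 5) ^ DIM('a)\<close> turns the volume
          of \<open>?B\<close> into that of the small ball around \<open>x\<close>.\<close>
        also have "\<dots> = (1 - \<alpha>) * (5 / \<eta>) ^ DIM('a) * ((\<eta> / 5) ^ DIM('a) * measure lebesgue ?B)"
          using \<eta> by (simp add: power_divide)
        also have "(\<eta> / 5) ^ DIM('a) * measure lebesgue ?B = measure lebesgue (ball x (?\<rho> x))"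
          using \<eta> rg by (intro measure_ball_scale[symmetric]) auto
        finally show ?thesis unfolding small .
      qed
    qed (fact Am Wm)+
  qed
  have "\<Union>\<F> \<subseteq> E \<union> (A \<union> (\<Union>\<F> - D))" by (auto simp: A_def)
  then have "measure lebesgue (\<Union>\<F>) \<le> measure lebesgue (E \<union> (A \<union> (\<Union>\<F> - D)))"
    using E Am Wm Dm by (intro measure_mono_fmeasurable fmeasurable.Un fmeasurable_Diff fmeasurableD)
  also have "\<dots> \<le> measure lebesgue E + (measure lebesgue A + measure lebesgue (\<Union>\<F> - D))"
    using E Am Wm Dm
    by (intro measure_Un_le[THEN order_trans] add_left_mono measure_Un_le sets.Un sets.Diff fmeasurableD)
  finally show ?thesis using shell deep by (simp add: algebra_simps)
qed

text \<open>Losing at most the fraction \<open>q\<close> of every finite union bounds the deficit by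
  \<open>q\<close>. The deficit is also the quantity compared in
  \<open>C_HL_b_deficit_mono\<close>.\<close>

lemma solyanik_estimate:
  assumes \<alpha>: "0 < \<alpha>" "\<alpha> < 1"
  shows "1 - 1 / C_HL_b TYPE('a::euclidean_space) \<alpha>
       \<le> (real DIM('a) + 5 ^ DIM('a)) * (1 - \<alpha>) powr (1 / (real DIM('a) + 1))"
proof -
  let ?n = "DIM('a)" and ?C = "C_HL_b TYPE('a) \<alpha>"
  \<comment> \<open>With \<open>n = DIM('a)\<close>, this makes
    \<open>\<eta> ^ (n + 1) = 1 - \<alpha>\<close>, so both error terms become multiples of
    \<eta>.\<close>
  define \<eta> where "\<eta> = (1 - \<alpha>) powr (1 / (real ?n + 1))"
  define q where "q = (real ?n + 5 ^ ?n) * \<eta>"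
  have \<eta>: "0 < \<eta>" "\<eta> < 1"
    using \<alpha> powr_less_mono2[of "1 / (real ?n + 1)" "1 - \<alpha>" 1] by (auto simp: \<eta>_def)
  have "\<eta> ^ Suc ?n = 1 - \<alpha>"
    using \<alpha> \<eta> by (subst powr_realpow[symmetric]) (auto simp: \<eta>_def powr_powr add.commute)
  then have "(1 - \<alpha>) * (5 / \<eta>) ^ ?n = 5 ^ ?n * \<eta>"
    using \<eta> by (simp add: power_divide field_simps flip: \<open>\<eta> ^ Suc ?n = 1 - \<alpha>\<close>)
  then have q: "real ?n * \<eta> + (1 - \<alpha>) * (5 / \<eta>) ^ ?n = q" by (simp add: q_def algebra_simps)
  have C1: "1 \<le> ?C" using C_HL_b_ge_1[OF \<alpha>] .
  \<comment> \<open>For \<open>q < 1\<close> the lost fraction is absorbed on the left; otherwise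
    the claim holds because a deficit is at most 1.\<close>
  have "1 - 1 / ?C \<le> q"
  proof (cases "q < 1")
    case True
    have "tauberian_bound TYPE('a) \<alpha> (1 / (1 - q))"
      unfolding tauberian_bound_def
    proof (intro conjI allI impI; (elim conjE)?)
      fix E :: "'a set" and \<F>
      assume "E \<in> lmeasurable" "finite \<F>" "\<F> \<subseteq> dense_balls \<alpha> E"
      then have "measure lebesgue (\<Union>\<F>) \<le> measure lebesgue E + q * measure lebesgue (\<Union>\<F>)"
        using dense_balls_union_bound[of E \<F> \<alpha> \<eta>] \<alpha> \<eta> q by simp
      then show "measure lebesgue (\<Union>\<F>) \<le> 1 / (1 - q) * measure lebesgue E"
        using True by (simp add: field_simps)
    qed (use True in simp)
    then have "?C \<le> 1 / (1 - q)" using \<alpha> by (intro C_HL_b_le) auto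
    then show ?thesis using C1 True by (simp add: field_simps)
  next
    case False
    then show ?thesis using C1 by (smt (verit) divide_nonneg_nonneg)
  qed
  then show ?thesis by (simp add: q_def \<eta>_def)
qed

text \<open>Enlarging \<open>E\<close> by a subset of the complement having relative density \<open>\<theta>\<close> in the complement
  of \<open>E\<close> in each ball raises the densities from above \<open>\<alpha>\<close> to above \<open>\<theta> + (1 - \<theta>) \<alpha> = \<beta>\<close>.\<close>

lemma C_HL_b_deficit_mono:
  assumes \<alpha>: "0 < \<alpha>" and le: "\<alpha> \<le> \<beta>" and \<beta>: "\<beta> < 1"
  shows "(1 - 1 / C_HL_b TYPE('a::euclidean_space) \<alpha>) / (1 - \<alpha>)
       \<le> (1 - 1 / C_HL_b TYPE('a) \<beta>) / (1 - \<beta>)"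
proof -
  define D where "D = C_HL_b TYPE('a) \<beta>"
  define \<theta> where "\<theta> = (\<beta> - \<alpha>) / (1 - \<alpha>)"
  have \<theta>: "0 \<le> \<theta>" "\<theta> < 1" using \<alpha> le \<beta> by (auto simp: \<theta>_def field_simps)
  have \<theta>1: "1 - \<theta> = (1 - \<beta>) / (1 - \<alpha>)" using le \<beta> by (simp add: \<theta>_def field_simps)
  have "\<theta> * (1 - \<alpha>) = \<beta> - \<alpha>" using le \<beta> by (simp add: \<theta>_def)
  then have \<beta>_eq: "\<theta> + (1 - \<theta>) * \<alpha> = \<beta>" by (simp add: algebra_simps)
  have D1: "1 \<le> D" unfolding D_def using \<alpha> le \<beta> by (intro C_HL_b_ge_1) auto
  have C1: "1 \<le> C_HL_b TYPE('a) \<alpha>" using \<alpha> le \<beta> by (intro C_HL_b_ge_1) auto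
  have D: "tauberian_bound TYPE('a) \<beta> D"
    unfolding D_def using tauberian_bound_C_HL_b[OF tauberian_bound_weak_type[where 'a='a]] \<alpha> le by simp
  \<comment> \<open>The deficit inequality in reciprocal form. It is immediate when
    \<open>\<theta> * D \<ge> 1\<close>; otherwise the measure of the union can be absorbed.\<close>
  have "1 / D \<le> \<theta> + (1 - \<theta>) * (1 / C_HL_b TYPE('a) \<alpha>)"
  proof (cases "\<theta> * D < 1")
    case True
    \<comment> \<open>The constant comes from solving
      \<open>|W| \<le> D ((1 - \<theta>) |E \<inter> W| + \<theta> |W|)\<close> for
      \<open>|W|\<close>.\<close>
    have "tauberian_bound TYPE('a) \<alpha> (D * (1 - \<theta>) / (1 - \<theta> * D))"
      unfolding tauberian_bound_def
    proof (intro conjI allI impI; (elim conjE)?)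
      fix E :: "'a set" and \<F>
      assume E: "E \<in> lmeasurable" and F: "finite \<F>" "\<F> \<subseteq> dense_balls \<alpha> E"
      let ?W = "\<Union>\<F>"
      have Wm: "?W \<in> lmeasurable" by (rule lmeasurable_Union_dense_balls[OF F])
      have EWm: "E \<inter> ?W \<in> lmeasurable" using E Wm by (intro fmeasurable_Int_fmeasurable fmeasurableD)
      have WE: "?W - E \<in> lmeasurable" using E Wm by (intro fmeasurable_Diff fmeasurableD)
      have Fm: "\<F> \<subseteq> lmeasurable" using F lmeasurable_dense_balls by blast
      obtain G where G: "G \<subseteq> ?W - E" "G \<in> lmeasurable"
        "measure lebesgue G = \<theta> * measure lebesgue (?W - E)"
        "\<And>B. B \<in> \<F> \<Longrightarrow> measure lebesgue (G \<inter> B) = \<theta> * measure lebesgue ((?W - E) \<inter> B)"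
        using exists_equidistributed_subset[OF F(1) Fm WE \<theta>] by blast
      have split: "measure lebesgue (X \<union> Y) = measure lebesgue X + measure lebesgue Y"
        if "X \<in> lmeasurable" "Y \<in> lmeasurable" "X \<inter> Y = {}" for X Y :: "'a set"
        using that by (simp add: measure_Un3)
      \<comment> \<open>The part of \<open>E\<close> outside \<open>?W\<close> meets no ball of
        \<open>\<F>\<close>; dropping it makes the measure of \<open>?E\<close> a combination of
        those of \<open>E \<inter> ?W\<close> and \<open>?W\<close>.\<close>
      let ?E = "(E \<inter> ?W) \<union> G"
      have W_split: "measure lebesgue ?W = measure lebesgue (E \<inter> ?W) + measure lebesgue (?W - E)"
      proof -
        have "(E \<inter> ?W) \<union> (?W - E) = ?W" "(E \<inter> ?W) \<inter> (?W - E) = {}" by auto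
        then show ?thesis using split[OF EWm WE] by simp
      qed
      have "(E \<inter> ?W) \<inter> G = {}" using G(1) by auto
      then have E_split: "measure lebesgue ?E = measure lebesgue (E \<inter> ?W) + \<theta> * measure lebesgue (?W - E)"
        using split[OF EWm G(2)] G(3) by simp
      have "\<F> \<subseteq> dense_balls \<beta> ?E"
      proof
        fix B assume B: "B \<in> \<F>"
        then obtain c r where cr: "B = ball c r" "0 < r"
          and d: "\<alpha> * measure lebesgue B < measure lebesgue (E \<inter> B)"
          using F(2) by (auto simp: dense_balls_def)
        have Bm: "B \<in> lmeasurable" and BW: "B \<subseteq> ?W" using B Fm by auto
        have m: "E \<inter> B \<in> lmeasurable" "G \<inter> B \<in> lmeasurable" "(?W - E) \<inter> B \<in> lmeasurable"
          using E G(2) WE Bm by (auto intro: fmeasurable_Int_fmeasurable simp: fmeasurableD)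
        have "(E \<inter> B) \<union> ((?W - E) \<inter> B) = B" "(E \<inter> B) \<inter> ((?W - E) \<inter> B) = {}" using BW by auto
        then have B_split: "measure lebesgue B = measure lebesgue (E \<inter> B) + measure lebesgue ((?W - E) \<inter> B)"
          using split[OF m(1,3)] by simp
        have "?E \<inter> B = (E \<inter> B) \<union> (G \<inter> B)" "(E \<inter> B) \<inter> (G \<inter> B) = {}" using BW G(1) by auto
        then have "measure lebesgue (?E \<inter> B)
            = measure lebesgue (E \<inter> B) + \<theta> * (measure lebesgue B - measure lebesgue (E \<inter> B))"
          using split[OF m(1,2)] G(4)[OF B] B_split by simp
        also have "\<dots> = \<theta> * measure lebesgue B + (1 - \<theta>) * measure lebesgue (E \<inter> B)"
          by (simp add: algebra_simps)
        also have "\<dots> > \<theta> * measure lebesgue B + (1 - \<theta>) * (\<alpha> * measure lebesgue B)"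
          using d \<theta> by simp
        also have "\<theta> * measure lebesgue B + (1 - \<theta>) * (\<alpha> * measure lebesgue B)
            = \<beta> * measure lebesgue B"
          unfolding \<beta>_eq[symmetric] by (simp add: algebra_simps)
        finally show "B \<in> dense_balls \<beta> ?E" unfolding dense_balls_def using cr by blast
      qed
      then have "measure lebesgue ?W \<le> D * measure lebesgue ?E"
        using D F(1) EWm G(2) unfolding tauberian_bound_def by (meson fmeasurable.Un)
      also have "measure lebesgue ?E = (1 - \<theta>) * measure lebesgue (E \<inter> ?W) + \<theta> * measure lebesgue ?W"
        unfolding E_split W_split by (simp add: algebra_simps)
      finally have "(1 - \<theta> * D) * measure lebesgue ?W \<le> D * (1 - \<theta>) * measure lebesgue (E \<inter> ?W)"
        by (simp add: algebra_simps)
      also have "\<dots> \<le> D * (1 - \<theta>) * measure lebesgue E"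
        using D1 \<theta> E EWm by (intro mult_left_mono measure_mono_fmeasurable) (auto simp: fmeasurableD)
      finally show "measure lebesgue ?W \<le> D * (1 - \<theta>) / (1 - \<theta> * D) * measure lebesgue E"
        using True by (simp add: pos_le_divide_eq mult.commute)
    next
      show "0 \<le> D * (1 - \<theta>) / (1 - \<theta> * D)" using D1 \<theta> True by simp
    qed
    then have "C_HL_b TYPE('a) \<alpha> \<le> D * (1 - \<theta>) / (1 - \<theta> * D)"
      using \<alpha> by (intro C_HL_b_le) auto
    then have "C_HL_b TYPE('a) \<alpha> * (1 - \<theta> * D) \<le> D * (1 - \<theta>)"
      using True by (simp add: pos_le_divide_eq)
    then show ?thesis using C1 D1 by (simp add: field_simps)
  next
    case False
    then have "1 / D \<le> \<theta>" using D1 by (simp add: field_simps)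
    also have "\<theta> \<le> \<theta> + (1 - \<theta>) * (1 / C_HL_b TYPE('a) \<alpha>)" using \<theta> C1 by simp
    finally show ?thesis .
  qed
  then have "(1 - \<theta>) * (1 - 1 / C_HL_b TYPE('a) \<alpha>) \<le> 1 - 1 / D" by (simp add: algebra_simps)
  then show ?thesis
    unfolding \<theta>1 D_def[symmetric] using le \<beta> by (simp add: pos_le_divide_eq mult.commute)
qed

section \<open>Regularity of \<open>C_HL_b\<close>\<close>

text \<open>Monotonicity of the deficit bounds the difference of the reciprocals; multiplying by
  both values of \<open>C_HL_b\<close>, each at most the value at \<open>a\<close>, returns to
  \<open>C_HL_b\<close>. The deficit at \<open>x\<close> stays as a factor: the bound 1 for it gives
  Lipschitz continuity away from 1, the Solyanik estimate gives a Hoelder bound up to 1.\<close>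

lemma C_HL_b_diff_le:
  assumes a: "0 < a" "a \<le> x" and xy: "x \<le> y" "y < 1"
  shows "\<bar>C_HL_b TYPE('a::euclidean_space) x - C_HL_b TYPE('a) y\<bar>
    \<le> (C_HL_b TYPE('a) a)\<^sup>2 * ((1 - 1 / C_HL_b TYPE('a) x) * ((y - x) / (1 - x)))"
proof -
  let ?C = "C_HL_b TYPE('a)"
  have C1: "1 \<le> ?C x" "1 \<le> ?C y" using a xy by (auto intro!: C_HL_b_ge_1)
  have "?C y \<le> ?C x" "?C x \<le> ?C a" using a xy by (auto intro!: C_HL_b_antimono)
  define s where "s = (y - x) / (1 - x)"
  have s: "(1 - y) / (1 - x) = 1 - s" using xy by (simp add: s_def field_simps)
  have "(1 - 1 / ?C x) * ((1 - y) / (1 - x)) \<le> 1 - 1 / ?C y"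
    using C_HL_b_deficit_mono[where 'a='a, of x y] a xy by (simp add: pos_le_divide_eq)
  then have diff: "1 / ?C y - 1 / ?C x \<le> (1 - 1 / ?C x) * ((y - x) / (1 - x))"
    unfolding s s_def[symmetric] by (simp add: right_diff_distrib)
  have "\<bar>?C x - ?C y\<bar> = ?C x * ?C y * (1 / ?C y - 1 / ?C x)"
    using C1 \<open>?C y \<le> ?C x\<close> by (simp add: field_simps)
  also have "\<dots> \<le> (?C a)\<^sup>2 * ((1 - 1 / ?C x) * ((y - x) / (1 - x)))"
    unfolding power2_eq_square
    using C1 \<open>?C y \<le> ?C x\<close> \<open>?C x \<le> ?C a\<close> diff by (intro mult_mono mult_nonneg_nonneg) (auto simp: field_simps)
  finally show ?thesis .
qed

lemma le_powr_unit:
  fixes s p :: real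
  assumes "0 \<le> s" "s \<le> 1" "p \<le> 1"
  shows "s \<le> s powr p"
  using powr_mono'[of p 1 s] assms by simp

lemma C_HL_b_Lipschitz:
  assumes ab: "0 < a" "b < 1" and x: "x \<in> {a..b}" and y: "y \<in> {a..b}"
  shows "\<bar>C_HL_b TYPE('a::euclidean_space) x - C_HL_b TYPE('a) y\<bar>
    \<le> (C_HL_b TYPE('a) a)\<^sup>2 / (1 - b) * \<bar>x - y\<bar>"
proof -
  let ?C = "C_HL_b TYPE('a)"
  have "\<bar>?C x - ?C y\<bar> \<le> (?C a)\<^sup>2 / (1 - b) * (y - x)" if h: "a \<le> x" "x \<le> y" "y \<le> b" for x y
  proof -
    have C1: "1 \<le> ?C x" using ab h by (intro C_HL_b_ge_1) auto
    have "(1 - 1 / ?C x) * ((y - x) / (1 - x)) \<le> 1 * ((y - x) / (1 - b))"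
      using ab h C1 by (intro mult_mono divide_left_mono) auto
    then have "(?C a)\<^sup>2 * ((1 - 1 / ?C x) * ((y - x) / (1 - x))) \<le> (?C a)\<^sup>2 * ((y - x) / (1 - b))"
      by (intro mult_left_mono) auto
    then show ?thesis using C_HL_b_diff_le[where 'a='a, of a x y] ab h by simp
  qed
  from this[of x y] this[of y x] show ?thesis
    using x y by (cases "x \<le> y") (auto simp: abs_minus_commute)
qed

text \<open>The powers of \<open>1 - x\<close> in the Solyanik estimate and in the quotient
  \<open>(y - x) / (1 - x)\<close> cancel, so the constant is uniform up to 1, as needed for
  \<open>phi_HL_b\<close> near 1.\<close>

lemma C_HL_b_Hoelder:
  assumes a: "0 < a" and x: "a \<le> x" "x < 1" and y: "a \<le> y" "y < 1"
  shows "\<bar>C_HL_b TYPE('a::euclidean_space) x - C_HL_b TYPE('a) y\<bar>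
    \<le> (C_HL_b TYPE('a) a)\<^sup>2 * (real DIM('a) + 5 ^ DIM('a)) * \<bar>x - y\<bar> powr (1 / (real DIM('a) + 1))"
proof -
  let ?C = "C_HL_b TYPE('a)" and ?p = "1 / (real DIM('a) + 1)"
  define k where "k = real DIM('a) + 5 ^ DIM('a)"
  have k: "0 \<le> k" by (simp add: k_def)
  have "\<bar>?C x - ?C y\<bar> \<le> (?C a)\<^sup>2 * k * (y - x) powr ?p" if h: "a \<le> x" "x \<le> y" "y < 1" for x y
  proof -
    have s: "0 \<le> (y - x) / (1 - x)" "(y - x) / (1 - x) \<le> 1" using h by auto
    have "(1 - 1 / ?C x) * ((y - x) / (1 - x)) \<le> (k * (1 - x) powr ?p) * ((y - x) / (1 - x)) powr ?p"
      using solyanik_estimate[where 'a='a, of x] s a h k unfolding k_def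
      by (intro mult_mono le_powr_unit) auto
    also have "\<dots> = k * (y - x) powr ?p" using h by (simp add: powr_divide)
    finally have "(?C a)\<^sup>2 * ((1 - 1 / ?C x) * ((y - x) / (1 - x))) \<le> (?C a)\<^sup>2 * (k * (y - x) powr ?p)"
      by (intro mult_left_mono) auto
    then show ?thesis using C_HL_b_diff_le[where 'a='a, of a x y] a h by simp
  qed
  from this[of x y] this[of y x] show ?thesis
    using x y unfolding k_def by (cases "x \<le> y") (auto simp: abs_minus_commute)
qed

text \<open>Compact subsets stay away from 0 and 1, so the Lipschitz bound applies; as distances are
  below 1, it implies every exponent at most 1, in particular the reciprocal of the
  dimension.\<close>

lemma holder_on_C_HL_b:
  assumes p: "p \<le> 1"
  shows "holder_on p {0<..<1} (C_HL_b TYPE('a::euclidean_space))"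
  unfolding holder_on_def
proof (intro allI impI; elim conjE)
  fix K :: "real set"
  assume K: "compact K" "K \<subseteq> {0<..<1}"
  show "\<exists>L. \<forall>x\<in>K. \<forall>y\<in>K. \<bar>C_HL_b TYPE('a) x - C_HL_b TYPE('a) y\<bar> \<le> L * \<bar>x - y\<bar> powr p"
  proof (cases "K = {}")
    case False
    obtain a where a: "a \<in> K" "\<forall>x\<in>K. a \<le> x" using compact_attains_inf[OF K(1) False] by blast
    obtain b where b: "b \<in> K" "\<forall>x\<in>K. x \<le> b" using compact_attains_sup[OF K(1) False] by blast
    have ab: "0 < a" "b < 1" using a b K by auto
    define L where "L = (C_HL_b TYPE('a) a)\<^sup>2 / (1 - b)"
    have "\<bar>C_HL_b TYPE('a) x - C_HL_b TYPE('a) y\<bar> \<le> L * \<bar>x - y\<bar> powr p" if xy: "x \<in> K" "y \<in> K" for x y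
    proof -
      have "\<bar>C_HL_b TYPE('a) x - C_HL_b TYPE('a) y\<bar> \<le> L * \<bar>x - y\<bar>"
        unfolding L_def using a b xy by (intro C_HL_b_Lipschitz ab) auto
      also have "\<dots> \<le> L * \<bar>x - y\<bar> powr p"
      proof (intro mult_left_mono le_powr_unit p)
        have "0 < x" "x < 1" "0 < y" "y < 1" using xy K by auto
        then show "\<bar>x - y\<bar> \<le> 1" by auto
        show "0 \<le> L" using ab by (simp add: L_def)
      qed auto
      finally show ?thesis .
    qed
    then show ?thesis by blast
  qed auto
qed

section \<open>Regularity of \<open>phi_HL_b\<close>\<close>

lemma abs_inverse_diff_le:
  fixes x y :: real
  assumes "1 \<le> x" "1 \<le> y"
  shows "\<bar>1 / x - 1 / y\<bar> \<le> \<bar>x - y\<bar>"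
proof -
  have "1 / x - 1 / y = (y - x) / (x * y)" using assms by (simp add: field_simps)
  then have "\<bar>1 / x - 1 / y\<bar> = \<bar>x - y\<bar> / (x * y)" using assms by (simp add: abs_mult abs_minus_commute)
  also have "\<dots> \<le> \<bar>x - y\<bar> / 1" using assms mult_mono[of 1 x 1 y] by (intro divide_left_mono) auto
  finally show ?thesis by simp
qed

text \<open>Inversion carries compact subsets of \<open>{1<..}\<close> to compact subsets of
  \<open>{0<..<1}\<close> and does not increase distances, so the regularity of
  \<open>C_HL_b\<close> transfers.\<close>

lemma holder_on_phi_HL_b:
  assumes p: "0 \<le> p" "p \<le> 1"
  shows "holder_on p {1<..} (phi_HL_b TYPE('a::euclidean_space))"
  unfolding holder_on_def
proof (intro allI impI; elim conjE)
  fix K :: "real set"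
  assume K: "compact K" "K \<subseteq> {1<..}"
  have "compact ((\<lambda>x. 1 / x) ` K)"
    using K by (intro compact_continuous_image continuous_intros) auto
  moreover have "(\<lambda>x. 1 / x) ` K \<subseteq> {0<..<1}" using K by auto
  ultimately obtain L where L: "\<And>x y. x \<in> K \<Longrightarrow> y \<in> K \<Longrightarrow>
      \<bar>C_HL_b TYPE('a) (1 / x) - C_HL_b TYPE('a) (1 / y)\<bar> \<le> L * \<bar>1 / x - 1 / y\<bar> powr p"
    using holder_on_C_HL_b[OF p(2), where 'a='a] unfolding holder_on_def by (metis imageI)
  \<comment> \<open>\<open>L\<close> was obtained without a sign, hence the absolute value in the
    constant.\<close>
  have "\<bar>phi_HL_b TYPE('a) x - phi_HL_b TYPE('a) y\<bar> \<le> \<bar>L\<bar> * \<bar>x - y\<bar> powr p" if xy: "x \<in> K" "y \<in> K" for x y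
  proof -
    have gt: "1 < x" "1 < y" using xy K by auto
    have "\<bar>phi_HL_b TYPE('a) x - phi_HL_b TYPE('a) y\<bar> \<le> L * \<bar>1 / x - 1 / y\<bar> powr p"
      using L[OF xy] gt by (simp add: phi_HL_b_def)
    also have "\<dots> \<le> \<bar>L\<bar> * \<bar>x - y\<bar> powr p"
      using p gt by (intro mult_mono powr_mono2 abs_inverse_diff_le) auto
    finally show ?thesis .
  qed
  then show "\<exists>L. \<forall>x\<in>K. \<forall>y\<in>K. \<bar>phi_HL_b TYPE('a) x - phi_HL_b TYPE('a) y\<bar> \<le> L * \<bar>x - y\<bar> powr p"
    by blast
qed

text \<open>Up to 1 the function is the identity, above 1 the Hoelder bound for
  \<open>C_HL_b\<close> applies, and across 1 the two contributions add, whence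
  \<open>L + 1\<close>.\<close>

lemma phi_HL_b_Hoelder:
  fixes x y b :: real
  defines "p \<equiv> 1 / (real DIM('a::euclidean_space) + 1)"
  defines "L \<equiv> (C_HL_b TYPE('a) (1 / b))\<^sup>2 * (real DIM('a) + 5 ^ DIM('a))"
  assumes b: "1 < b" and xy: "0 \<le> x" "x \<le> y" "y \<le> b"
  shows "\<bar>phi_HL_b TYPE('a) x - phi_HL_b TYPE('a) y\<bar> \<le> (L + 1) * (y - x) powr p"
proof -
  let ?C = "C_HL_b TYPE('a)"
  have p: "0 \<le> p" "p \<le> 1" by (auto simp: p_def)
  have Cb: "1 \<le> ?C (1 / b)" using b by (intro C_HL_b_ge_1) auto
  have L: "0 \<le> L" by (simp add: L_def)
  consider "y \<le> 1" | "1 < x" | "x \<le> 1" "1 < y" using xy by linarith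
  then show ?thesis
  proof cases
    case 1
    have "\<bar>phi_HL_b TYPE('a) x - phi_HL_b TYPE('a) y\<bar> = y - x" using 1 xy by (simp add: phi_HL_b_def)
    also have "\<dots> \<le> (y - x) powr p" using 1 xy p by (intro le_powr_unit) auto
    also have "\<dots> \<le> (L + 1) * (y - x) powr p" using L by (simp add: mult_le_cancel_right1)
    finally show ?thesis .
  next
    case 2
    have "\<bar>phi_HL_b TYPE('a) x - phi_HL_b TYPE('a) y\<bar> = \<bar>?C (1 / x) - ?C (1 / y)\<bar>"
      using 2 xy by (simp add: phi_HL_b_def)
    also have "\<dots> \<le> L * \<bar>1 / x - 1 / y\<bar> powr p"
      unfolding L_def p_def using 2 b xy by (intro C_HL_b_Hoelder) (auto intro: divide_left_mono)
    also have "\<dots> \<le> (L + 1) * (y - x) powr p"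
      using abs_inverse_diff_le[of x y] 2 xy L p by (intro mult_mono powr_mono2) auto
    finally show ?thesis .
  next
    case 3
    have Cy: "1 \<le> ?C (1 / y)" "?C (1 / y) \<le> ?C (1 / b)"
      using 3 b xy by (auto intro!: C_HL_b_ge_1 C_HL_b_antimono divide_left_mono)
    \<comment> \<open>Writing \<open>C - 1\<close> as \<open>C\<close> times the deficit lets the
      Solyanik estimate control the rise above the value 1 taken at 1.\<close>
    have "?C (1 / y) - 1 = ?C (1 / y) * (1 - 1 / ?C (1 / y))"
      using Cy by (simp add: field_simps)
    also have "\<dots> \<le> (?C (1 / b))\<^sup>2 * ((real DIM('a) + 5 ^ DIM('a)) * (1 - 1 / y) powr p)"
    proof (intro mult_mono)
      have "?C (1 / b) * 1 \<le> ?C (1 / b) * ?C (1 / b)" using Cb by (intro mult_left_mono) auto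
      then show "?C (1 / y) \<le> (?C (1 / b))\<^sup>2" using Cy unfolding power2_eq_square by linarith
      show "1 - 1 / ?C (1 / y) \<le> (real DIM('a) + 5 ^ DIM('a)) * (1 - 1 / y) powr p"
        unfolding p_def using 3 by (intro solyanik_estimate) auto
    qed (use Cy in auto)
    also have "\<dots> = L * (1 - 1 / y) powr p" by (simp add: L_def)
    also have "\<dots> \<le> L * (y - x) powr p"
    proof (intro mult_left_mono powr_mono2)
      \<comment> \<open>Since \<open>x \<le> 1\<close>, the distance from \<open>y\<close> to 1 is
        at most \<open>y - x\<close>.\<close>
      have "1 - 1 / y \<le> y - 1" using abs_inverse_diff_le[of 1 y] 3 by simp
      then show "1 - 1 / y \<le> y - x" using 3 by simp
    qed (use 3 p L in auto)
    finally have "?C (1 / y) - 1 \<le> L * (y - x) powr p" .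
    moreover have "1 - x \<le> (y - x) powr p"
    proof -
      have "1 - x \<le> (1 - x) powr p" using 3 xy p by (intro le_powr_unit) auto
      also have "\<dots> \<le> (y - x) powr p" using 3 p by (intro powr_mono2) auto
      finally show ?thesis .
    qed
    ultimately show ?thesis using 3 Cy by (simp add: phi_HL_b_def algebra_simps)
  qed
qed

lemma holder_on_phi_HL_b_atLeast_0:
  "holder_on (1 / (real DIM('a::euclidean_space) + 1)) {0..} (phi_HL_b TYPE('a))"
  unfolding holder_on_def
proof (intro allI impI; elim conjE)
  fix K :: "real set"
  assume K: "compact K" "K \<subseteq> {0..}"
  obtain b0 where b0: "\<And>x. x \<in> K \<Longrightarrow> \<bar>x\<bar> \<le> b0"
    using compact_imp_bounded[OF K(1)] by (auto simp: bounded_iff)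
  \<comment> \<open>The 2 ensures \<open>1 < b\<close>, so that \<open>1 / b\<close> lies strictly
    between 0 and 1.\<close>
  define b where "b = max 2 b0"
  have b: "1 < b" "\<And>x. x \<in> K \<Longrightarrow> x \<le> b" using b0 by (fastforce simp: b_def)+
  define L where "L = (C_HL_b TYPE('a) (1 / b))\<^sup>2 * (real DIM('a) + 5 ^ DIM('a)) + 1"
  have "\<bar>phi_HL_b TYPE('a) x - phi_HL_b TYPE('a) y\<bar> \<le> L * \<bar>x - y\<bar> powr (1 / (real DIM('a) + 1))"
    if xy: "x \<in> K" "y \<in> K" for x y
  proof -
    have "0 \<le> x" "0 \<le> y" "x \<le> b" "y \<le> b" using xy K b by auto
    then show ?thesis
      using phi_HL_b_Hoelder[where 'a='a, of b x y] phi_HL_b_Hoelder[where 'a='a, of b y x] b(1)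
      unfolding L_def by (cases "x \<le> y") (auto simp: abs_minus_commute)
  qed
  then show "\<exists>L. \<forall>x\<in>K. \<forall>y\<in>K. \<bar>phi_HL_b TYPE('a) x - phi_HL_b TYPE('a) y\<bar>
      \<le> L * \<bar>x - y\<bar> powr (1 / (real DIM('a) + 1))"
    by blast
qed

theorem theorem3:
  shows "holder_on (1 / (real DIM('a::euclidean_space) + 1)) {0..} (phi_HL_b TYPE('a))
       \<and> holder_on (1 / real DIM('a)) {0<..<1} (C_HL_b TYPE('a))
       \<and> holder_on (1 / real DIM('a)) {1<..} (phi_HL_b TYPE('a))"
proof -
  have "1 \<le> real DIM('a)" using DIM_positive[where 'a='a] by linarith
  then have "0 \<le> 1 / real DIM('a)" "1 / real DIM('a) \<le> 1" by auto
  then show ?thesis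
    by (intro conjI holder_on_phi_HL_b_atLeast_0 holder_on_C_HL_b holder_on_phi_HL_b)
qed

end
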